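(* Let $\mathcal{F}:\mathcal{L}_n\to\mathcal{L}_n$ (of the form $\mathcal{F}(x(\cdot))(\xi)=F(x(\xi),\xi)$) be continuous, and assume that $\mathcal{F}$ is pseudomonotone on $\mathcal{C}\cap\mathcal{N}_n$. Then the set $\mathrm{SOL}(\mathcal{C}\cap\mathcal{N}_n,\mathcal{F})$ is nonempty and bounded if and only if $$(\mathcal{C}\cap\mathcal{N}_n)_\infty\cap\big[-\big(\mathcal{F}(\mathcal{C}\cap\mathcal{N}_n)^*\big)\big]=\{0\}.$$
   Context: Let $N\ge1$ and $n_1,\dots,n_N\ge 1$ be integers, $n=\sum_{k=1}^N n_k$. Let $\Xi=\Xi_1\times\cdots\times\Xi_N$ be a finite sample space whose elements $\xi=(\xi_1,\dots,\xi_N)$ have probabilities $p(\xi)>0$ summing to $1$. $\mathcal{L}_n$ is the Hilbert space of all maps $x(\cdot):\Xi\to\mathbb{R}^n$, $x(\xi)=(x_1(\xi),\dots,x_N(\xi))$ with $x_k(\xi)\in\mathbb{R}^{n_k}$, with inner product $\langle x(\cdot),w(\cdot)\rangle=\sum_{\xi\in\Xi}p(\xi)\sum_{k=1}^N\langle x_k(\xi),w_k(\xi)\rangle$. The nonanticipativity subspace is $\mathcal{N}_n=\{x(\cdot)\in\mathcal{L}_n: x_k(\xi)\text{ does not depend on }\xi_k,\dots,\xi_N,\ k=1,\dots,N\}$. For each $\xi\in\Xi$ let $C(\xi)\subset\mathbb{R}^n$ be nonempty closed convex, and $\mathcal{C}=\{x(\cdot)\in\mathcal{L}_n:x(\xi)\in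 C(\xi)\ \forall\xi\in\Xi\}$. The mapping $\mathcal{F}$ is given by $\mathcal{F}(x(\cdot)):\xi\mapsto F(x(\xi),\xi)$, where $F(\cdot,\xi):\mathbb{R}^n\to\mathbb{R}^n$ for each $\xi$. $\mathrm{SOL}(\mathcal{C}\cap\mathcal{N}_n,\mathcal{F})$ is the solution set of the stochastic variational inequality: find $x(\cdot)\in\mathcal{C}\cap\mathcal{N}_n$ with $-\mathcal{F}(x(\cdot))\in N_{\mathcal{C}\cap\mathcal{N}_n}(x(\cdot))$, i.e. $\langle\mathcal{F}(x(\cdot)),y(\cdot)-x(\cdot)\rangle\ge0$ for all $y(\cdot)\in\mathcal{C}\cap\mathcal{N}_n$. $\mathcal{F}$ is pseudomonotone on a set $\mathcal{K}\subset\mathcal{L}_n$ if for all $x(\cdot),y(\cdot)\in\mathcal{K}$: $\langle y(\cdot)-x(\cdot),\mathcal{F}(x(\cdot))\rangle\ge0$ implies $\langle y(\cdot)-x(\cdot),\mathcal{F}(y(\cdot))\rangle\ge0$. For a set $S\subset\mathcal{L}_n$: $S_\infty=\{d:x+\tau d\in S\ \forall x\in S,\ \tau\ge0\}$ is the recession cone and $S^*=\{d:\langle v,d\rangle\ge0\ \forall v\in S\}$ is the dual cone; $\mathcal{F}(\mathcal{C}\cap\mathcal{N}_n)^*$ is the dual cone of the image set $\mathcal{F}(\mathcal{C}\cap\mathcal{N}_n)$. *)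

theory Defs
  imports "HOL-Analysis.Analysis"
begin

text \<open>
  Conventions. Stages are the elements of a finite linearly ordered type \<open>'k\<close>, so the number of
  stages is \<open>CARD('k)\<close>. A scenario is a tuple \<open>\<xi> :: 'a ^ 'k\<close> over a finite alphabet \<open>'a\<close>, and
  \<open>\<Omega> :: ('a ^ 'k) set\<close> is the sample space. The decision space is \<open>real ^ 'n\<close>, and
  \<open>st :: 'n \<Rightarrow> 'k\<close> assigns to every coordinate the stage it belongs to: the stage-\<open>k\<close> block has
  dimension \<open>card {i. st i = k}\<close>, these dimensions add up to \<open>CARD('n)\<close>, and they are all positive
  iff \<open>st\<close> is surjective.
\<close>

text \<open>Written with \<open>vec\<close> because the infix notation attaches a sort to its index type.\<close>

type_synonym ('a, 'k) scenario = "('a, 'k) vec"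
type_synonym ('n, 'a, 'k) policy = "((real, 'n) vec, ('a, 'k) scenario) vec"

text \<open>The component \<open>v\<^sub>k\<close> of \<open>v\<close>, padded with zeros in the coordinates of the other stages.\<close>

definition block :: "('n \<Rightarrow> 'k) \<Rightarrow> 'k \<Rightarrow> real ^ 'n \<Rightarrow> real ^ 'n" where
  "block st k v = (\<chi> i. if st i = k then v $ i else 0)"

text \<open>Maps \<open>\<Omega> \<rightarrow> \<real>\<^sup>n\<close> are represented by their extensions by zero to all of \<open>'a ^ 'k\<close>.\<close>

definition L_space ::
  "('a::finite, 'k::finite) scenario set \<Rightarrow> ('n::finite, 'a, 'k) policy set" where
  "L_space \<Omega> = {x. \<forall>\<xi>. \<xi> \<notin> \<Omega> \<longrightarrow> x $ \<xi> = 0}"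

definition L_inner ::
  "('n::finite \<Rightarrow> 'k::finite) \<Rightarrow> ('a::finite, 'k) scenario set \<Rightarrow> (('a, 'k) scenario \<Rightarrow> real) \<Rightarrow>
    ('n, 'a, 'k) policy \<Rightarrow> ('n, 'a, 'k) policy \<Rightarrow> real" where
  "L_inner st \<Omega> p x w =
    (\<Sum>\<xi>\<in>\<Omega>. p \<xi> * (\<Sum>k\<in>UNIV. block st k (x $ \<xi>) \<bullet> block st k (w $ \<xi>)))"

definition L_dist ::
  "('n::finite \<Rightarrow> 'k::finite) \<Rightarrow> ('a::finite, 'k) scenario set \<Rightarrow> (('a, 'k) scenario \<Rightarrow> real) \<Rightarrow>
    ('n, 'a, 'k) policy \<Rightarrow> ('n, 'a, 'k) policy \<Rightarrow> real" where
  "L_dist st \<Omega> p x y = sqrt (L_inner st \<Omega> p (x - y) (x - y))"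

text \<open>
  Continuity and boundedness refer to the norm induced by the weighted inner product, not to
  the type-class norm of \<open>(real ^ 'n) ^ ('a ^ 'k)\<close>.
\<close>

definition L_topology ::
  "('n::finite \<Rightarrow> 'k::finite) \<Rightarrow> ('a::finite, 'k) scenario set \<Rightarrow> (('a, 'k) scenario \<Rightarrow> real) \<Rightarrow>
    ('n, 'a, 'k) policy topology" where
  "L_topology st \<Omega> p = Metric_space.mtopology (L_space \<Omega>) (L_dist st \<Omega> p)"

definition L_bounded ::
  "('n::finite \<Rightarrow> 'k::finite) \<Rightarrow> ('a::finite, 'k) scenario set \<Rightarrow> (('a, 'k) scenario \<Rightarrow> real) \<Rightarrow>
    ('n, 'a, 'k) policy set \<Rightarrow> bool" where
  "L_bounded st \<Omega> p S \<longleftrightarrow> Metric_space.mbounded (L_space \<Omega>) (L_dist st \<Omega> p) S"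

text \<open>\<open>x\<^sub>k(\<xi>)\<close> may depend only on the components \<open>\<xi>\<^sub>j\<close> with \<open>j < k\<close>.\<close>

definition nonanticipative ::
  "('n::finite \<Rightarrow> 'k::{finite,linorder}) \<Rightarrow> ('a::finite, 'k) scenario set \<Rightarrow>
    ('n, 'a, 'k) policy set" where
  "nonanticipative st \<Omega> =
    {x \<in> L_space \<Omega>. \<forall>k. \<forall>\<xi>\<in>\<Omega>. \<forall>\<zeta>\<in>\<Omega>.
       (\<forall>j<k. \<xi> $ j = \<zeta> $ j) \<longrightarrow> block st k (x $ \<xi>) = block st k (x $ \<zeta>)}"

definition constraint_set ::
  "('a::finite, 'k::finite) scenario set \<Rightarrow> (('a, 'k) scenario \<Rightarrow> (real ^ 'n) set) \<Rightarrow>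
    ('n, 'a, 'k) policy set" where
  "constraint_set \<Omega> C = {x \<in> L_space \<Omega>. \<forall>\<xi>\<in>\<Omega>. x $ \<xi> \<in> C \<xi>}"

definition scenario_map ::
  "('a::finite, 'k::finite) scenario set \<Rightarrow> (real ^ 'n \<Rightarrow> ('a, 'k) scenario \<Rightarrow> real ^ 'n) \<Rightarrow>
    ('n, 'a, 'k) policy \<Rightarrow> ('n, 'a, 'k) policy" where
  "scenario_map \<Omega> F x = (\<chi> \<xi>. if \<xi> \<in> \<Omega> then F (x $ \<xi>) \<xi> else 0)"

definition SOL ::
  "('n::finite \<Rightarrow> 'k::finite) \<Rightarrow> ('a::finite, 'k) scenario set \<Rightarrow> (('a, 'k) scenario \<Rightarrow> real) \<Rightarrow>
    ('n, 'a, 'k) policy set \<Rightarrow> (('n, 'a, 'k) policy \<Rightarrow> ('n, 'a, 'k) policy) \<Rightarrow>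
    ('n, 'a, 'k) policy set" where
  "SOL st \<Omega> p K G = {x \<in> K. \<forall>y\<in>K. L_inner st \<Omega> p (G x) (y - x) \<ge> 0}"

definition pseudomonotone_on ::
  "('n::finite \<Rightarrow> 'k::finite) \<Rightarrow> ('a::finite, 'k) scenario set \<Rightarrow> (('a, 'k) scenario \<Rightarrow> real) \<Rightarrow>
    ('n, 'a, 'k) policy set \<Rightarrow> (('n, 'a, 'k) policy \<Rightarrow> ('n, 'a, 'k) policy) \<Rightarrow> bool" where
  "pseudomonotone_on st \<Omega> p K G \<longleftrightarrow>
    (\<forall>x\<in>K. \<forall>y\<in>K. L_inner st \<Omega> p (y - x) (G x) \<ge> 0 \<longrightarrow> L_inner st \<Omega> p (y - x) (G y) \<ge> 0)"

definition recession_cone ::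
  "('a::finite, 'k::finite) scenario set \<Rightarrow> ('n::finite, 'a, 'k) policy set \<Rightarrow>
    ('n, 'a, 'k) policy set" where
  "recession_cone \<Omega> S = {d \<in> L_space \<Omega>. \<forall>x\<in>S. \<forall>\<tau>::real. \<tau> \<ge> 0 \<longrightarrow> x + \<tau> *\<^sub>R d \<in> S}"

definition dual_cone ::
  "('n::finite \<Rightarrow> 'k::finite) \<Rightarrow> ('a::finite, 'k) scenario set \<Rightarrow> (('a, 'k) scenario \<Rightarrow> real) \<Rightarrow>
    ('n, 'a, 'k) policy set \<Rightarrow> ('n, 'a, 'k) policy set" where
  "dual_cone st \<Omega> p S = {d \<in> L_space \<Omega>. \<forall>v\<in>S. L_inner st \<Omega> p v d \<ge> 0}"

text \<open>The distance used above is a metric, so the metric-space constants have their meaning.\<close>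

lemma sum_block_inner: "(\<Sum>k\<in>UNIV. block st k v \<bullet> block st k w) = v \<bullet> w"
  for st :: "'n::finite \<Rightarrow> 'k::finite"
proof -
  have "(\<Sum>k\<in>UNIV. block st k v \<bullet> block st k w)
      = (\<Sum>k\<in>UNIV. \<Sum>i\<in>UNIV. if st i = k then v $ i * w $ i else 0)"
    by (simp add: block_def inner_vec_def if_distrib cong: if_cong sum.cong)
  also have "\<dots> = (\<Sum>i\<in>UNIV. \<Sum>k\<in>UNIV. if st i = k then v $ i * w $ i else 0)"
    by (rule sum.swap)
  also have "\<dots> = v \<bullet> w"
    by (simp add: inner_vec_def)
  finally show ?thesis .
qed

lemma L_dist_eq_norm:
  fixes st :: "'n::finite \<Rightarrow> 'k::finite"
  assumes "\<And>\<xi>. \<xi> \<in> \<Omega> \<Longrightarrow> p \<xi> > 0"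
  shows "L_dist st \<Omega> p x y = norm (\<chi> \<xi>. if \<xi> \<in> \<Omega> then sqrt (p \<xi>) *\<^sub>R (x - y) $ \<xi> else 0)"
proof -
  have "L_inner st \<Omega> p (x - y) (x - y)
      = (\<Sum>\<xi>\<in>UNIV. if \<xi> \<in> \<Omega> then p \<xi> * ((x - y) $ \<xi> \<bullet> (x - y) $ \<xi>) else 0)"
    unfolding L_inner_def sum_block_inner by (simp add: sum.If_cases)
  also have "\<dots> = (\<Sum>\<xi>\<in>UNIV. (norm (if \<xi> \<in> \<Omega> then sqrt (p \<xi>) *\<^sub>R (x - y) $ \<xi> else 0))\<^sup>2)"
    by (rule sum.cong)
      (use assms in \<open>auto simp: power_mult_distrib power2_norm_eq_inner less_imp_le\<close>)
  finally show ?thesis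
    by (simp add: L_dist_def norm_vec_def L2_set_def)
qed

lemma Metric_space_L:
  fixes st :: "'n::finite \<Rightarrow> 'k::finite" and \<Omega> :: "('a::finite, 'k) scenario set"
  assumes pos: "\<And>\<xi>. \<xi> \<in> \<Omega> \<Longrightarrow> p \<xi> > 0"
  shows "Metric_space (L_space \<Omega>) (L_dist st \<Omega> p)"
proof -
  define T :: "('n, 'a, 'k) policy \<Rightarrow> ('n, 'a, 'k) policy"
    where "T x = (\<chi> \<xi>. if \<xi> \<in> \<Omega> then sqrt (p \<xi>) *\<^sub>R x $ \<xi> else 0)" for x
  have T: "L_dist st \<Omega> p x y = dist (T x) (T y)" for x y
  proof -
    have "T x - T y = (\<chi> \<xi>. if \<xi> \<in> \<Omega> then sqrt (p \<xi>) *\<^sub>R (x - y) $ \<xi> else 0)"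
      by (simp add: T_def vec_eq_iff algebra_simps)
    then show ?thesis
      by (simp add: L_dist_eq_norm[OF pos] dist_norm)
  qed
  have inj: "x = y" if "x \<in> L_space \<Omega>" "y \<in> L_space \<Omega>" "T x = T y" for x y
  proof -
    have "x $ \<xi> = y $ \<xi>" for \<xi>
    proof (cases "\<xi> \<in> \<Omega>")
      case True
      have "T x $ \<xi> = T y $ \<xi>" using that by simp
      with True pos[OF True] show ?thesis by (simp add: T_def)
    next
      case False
      with that show ?thesis by (simp add: L_space_def)
    qed
    then show ?thesis by (simp add: vec_eq_iff)
  qed
  show ?thesis
    by unfold_locales (use inj in \<open>auto simp: T dist_commute dist_triangle\<close>)
qed

end

theory Submission
  imports Defs
begin

text \<open>
  The theorem is an instance of a fact about an arbitrary continuous pseudomonotone variational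
  inequality over a nonempty closed convex set \<open>K\<close> in a Euclidean space. The weighted inner product
  is the ordinary one with the weights \<open>p \<xi>\<close> moved onto one argument, so it suffices to multiply
  the mapping by the weights (\<open>weighted\<close>); since all weights lie in \<open>(0, 1]\<close>, the weighted metric
  is equivalent to the Euclidean one, and continuity and boundedness carry over.

  In the Euclidean setting everything rests on Minty's reformulation: \<open>x\<close> solves the inequality
  iff \<open>H y \<bullet> (y - x) \<ge> 0\<close> for all \<open>y \<in> K\<close>. Pseudomonotonicity gives one direction and continuity
  along segments the other (\<open>minty_imp_vi\<close>). The reformulated condition is linear in \<open>x\<close>, so the
  behaviour of solutions at infinity is governed by directions alone. A direction \<open>d\<close> that keeps
  \<open>K\<close> invariant and satisfies \<open>H y \<bullet> d \<le> 0\<close> on \<open>K\<close> can be added to any solution, so bounded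
  nonempty solution sets exclude \<open>d \<noteq> 0\<close>. Conversely, whenever points of \<open>K\<close> of unbounded norm
  satisfy Minty's inequality against more and more test points, a limit of their normalisations is
  such a direction and has norm one (\<open>unbounded_minty_sequence\<close>). This one compactness argument
  serves twice: it bounds the solution set, and it shows that the solutions on \<open>K \<inter> cball 0 r\<close>,
  which exist by Brouwer's theorem, cannot lie on the sphere for all \<open>r\<close>; a solution in the
  interior of the ball solves the inequality on all of \<open>K\<close>.
\<close>

section \<open>Pseudomonotone variational inequalities in Euclidean space\<close>

definition vi_solutions :: "'v::euclidean_space set \<Rightarrow> ('v \<Rightarrow> 'v) \<Rightarrow> 'v set" where
  "vi_solutions K H = {x \<in> K. \<forall>y\<in>K. H x \<bullet> (y - x) \<ge> 0}"

definition pseudomonotone :: "'v::euclidean_space set \<Rightarrow> ('v \<Rightarrow> 'v) \<Rightarrow> bool" where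
  "pseudomonotone K H \<longleftrightarrow>
    (\<forall>x\<in>K. \<forall>y\<in>K. H x \<bullet> (y - x) \<ge> 0 \<longrightarrow> H y \<bullet> (y - x) \<ge> 0)"

text \<open>
  The intersection of the recession cone of \<open>K\<close> with the negative of the dual cone of \<open>H ` K\<close>. A
  nonzero element is a ray along which Minty's inequality cannot stop solutions from escaping.
\<close>

definition critical_directions :: "'v::euclidean_space set \<Rightarrow> ('v \<Rightarrow> 'v) \<Rightarrow> 'v set" where
  "critical_directions K H =
    {d. (\<forall>x\<in>K. \<forall>\<tau>\<ge>0. x + \<tau> *\<^sub>R d \<in> K) \<and> (\<forall>y\<in>K. H y \<bullet> d \<le> 0)}"

text \<open>
  Minty's inequality at the point \<open>x + t (y - x)\<close> of the segment, divided by \<open>t\<close>, tends to the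
  desired inequality as \<open>t\<close> tends to zero.
\<close>

lemma minty_imp_vi:
  fixes K :: "'v::euclidean_space set"
  assumes K: "convex K" and H: "continuous_on K H" and x: "x \<in> K"
    and minty: "\<And>y. y \<in> K \<Longrightarrow> H y \<bullet> (y - x) \<ge> 0"
  shows "x \<in> vi_solutions K H"
proof -
  have "H x \<bullet> (y - x) \<ge> 0" if y: "y \<in> K" for y
  proof -
    define t :: "nat \<Rightarrow> real" where "t n = inverse (real (Suc n))" for n
    define u where "u n = x + t n *\<^sub>R (y - x)" for n
    have t: "0 < t n" "t n \<le> 1" for n
      by (auto simp: t_def field_simps)
    have uK: "u n \<in> K" for n
    proof -
      have "u n = (1 - t n) *\<^sub>R x + t n *\<^sub>R y"
        by (simp add: u_def algebra_simps)
      with convexD[OF K x y, of "1 - t n" "t n"] t[of n] show ?thesis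
        by simp
    qed
    have "t \<longlonglongrightarrow> 0"
      unfolding t_def by (rule LIMSEQ_inverse_real_of_nat)
    then have "u \<longlonglongrightarrow> x + 0 *\<^sub>R (y - x)"
      unfolding u_def by (intro tendsto_intros)
    then have "(\<lambda>n. H (u n)) \<longlonglongrightarrow> H x"
      using continuous_on_tendsto_compose[OF H, of u x sequentially] x uK by simp
    then have lim: "(\<lambda>n. H (u n) \<bullet> (y - x)) \<longlonglongrightarrow> H x \<bullet> (y - x)"
      by (intro tendsto_intros)
    have "H (u n) \<bullet> (y - x) \<ge> 0" for n
      using minty[OF uK[of n]] t[of n] by (simp add: u_def zero_le_mult_iff)
    then show ?thesis
      by (intro LIMSEQ_le_const[OF lim]) auto
  qed
  with x show ?thesis
    by (simp add: vi_solutions_def)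
qed

lemma vi_solution_minty:
  assumes "pseudomonotone K H" "x \<in> vi_solutions K H" "y \<in> K"
  shows "H y \<bullet> (y - x) \<ge> 0"
  using assms by (auto simp: pseudomonotone_def vi_solutions_def)

lemma vi_solution_plus_critical_direction:
  fixes K :: "'v::euclidean_space set"
  assumes K: "convex K" and H: "continuous_on K H" "pseudomonotone K H"
    and x: "x \<in> vi_solutions K H" and d: "d \<in> critical_directions K H" and "\<tau> \<ge> 0"
  shows "x + \<tau> *\<^sub>R d \<in> vi_solutions K H"
proof (rule minty_imp_vi[OF K H(1)])
  show "x + \<tau> *\<^sub>R d \<in> K"
    using x d \<open>\<tau> \<ge> 0\<close> by (auto simp: vi_solutions_def critical_directions_def)
next
  fix y assume y: "y \<in> K"
  have "\<tau> * (H y \<bullet> d) \<le> 0"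
    using d y \<open>\<tau> \<ge> 0\<close> by (auto simp: critical_directions_def mult_le_0_iff)
  with vi_solution_minty[OF H(2) x y] show "H y \<bullet> (y - (x + \<tau> *\<^sub>R d)) \<ge> 0"
    by (simp add: inner_diff_right inner_add_right)
qed

text \<open>
  The normalised points have a limit \<open>d\<close> of norm one. For \<open>x \<in> K\<close>, the point \<open>x + \<tau> d\<close> is a limit
  of convex combinations of \<open>x\<close> and \<open>X n\<close> with weights \<open>\<tau> / norm (X n)\<close>, and dividing Minty's
  inequality for \<open>X n\<close> by \<open>norm (X n)\<close> makes the contribution of the test point vanish.
\<close>

lemma unbounded_minty_sequence:
  fixes K :: "'v::euclidean_space set"
  assumes K: "closed K" "convex K"
    and X: "\<And>n. X n \<in> K" "\<And>n. norm (X n) \<ge> real n"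
    and minty: "\<And>y. y \<in> K \<Longrightarrow> \<forall>\<^sub>F n in sequentially. H y \<bullet> (y - X n) \<ge> 0"
  shows "\<exists>d \<in> critical_directions K H. d \<noteq> 0"
proof -
  define u where "u n = X (Suc n) /\<^sub>R norm (X (Suc n))" for n
  have pos: "norm (X (Suc n)) > 0" for n
    using X(2)[of "Suc n"] by linarith
  have "u n \<in> sphere 0 1" for n
    using pos[of n] by (auto simp: u_def)
  then obtain d r where d: "d \<in> sphere 0 1" and r: "strict_mono r" and ur: "(u \<circ> r) \<longlonglongrightarrow> d"
    using compact_sphere[of "0::'v" 1] unfolding compact_def by meson
  define s where "s n = inverse (norm (X (Suc (r n))))" for n
  have s_pos: "s n > 0" for n
    using pos[of "r n"] by (simp add: s_def)
  have s_le: "s n \<le> inverse (real (Suc n))" for n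
  proof -
    have "real (Suc n) \<le> real (Suc (r n))"
      using seq_suble[OF r, of n] by simp
    also have "\<dots> \<le> norm (X (Suc (r n)))"
      by (rule X(2))
    finally show ?thesis
      unfolding s_def by (intro le_imp_inverse_le) auto
  qed
  have s0: "s \<longlonglongrightarrow> 0"
    by (rule tendsto_sandwich[OF _ _ tendsto_const LIMSEQ_inverse_real_of_nat])
      (use s_le s_pos in \<open>auto intro!: always_eventually simp: less_imp_le\<close>)
  have sX: "(\<lambda>n. s n *\<^sub>R X (Suc (r n))) \<longlonglongrightarrow> d"
    using ur by (simp add: o_def u_def s_def)
  have "x + \<tau> *\<^sub>R d \<in> K" if x: "x \<in> K" and \<tau>: "\<tau> \<ge> 0" for x \<tau>
  proof -
    let ?z = "\<lambda>n. (1 - \<tau> * s n) *\<^sub>R x + \<tau> *\<^sub>R (s n *\<^sub>R X (Suc (r n)))"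
    have lim: "?z \<longlonglongrightarrow> (1 - \<tau> * 0) *\<^sub>R x + \<tau> *\<^sub>R d"
      by (intro tendsto_intros s0 sX)
    have "(\<lambda>n. \<tau> * s n) \<longlonglongrightarrow> \<tau> * 0"
      by (intro tendsto_intros s0)
    then have "\<forall>\<^sub>F n in sequentially. \<tau> * s n < 1"
      by (rule order_tendstoD) simp
    then have "\<forall>\<^sub>F n in sequentially. ?z n \<in> K"
    proof eventually_elim
      case (elim n)
      then show ?case
        using convexD[OF K(2) x X(1)[of "Suc (r n)"], of "1 - \<tau> * s n" "\<tau> * s n"] \<tau> s_pos[of n]
        by simp
    qed
    from Lim_in_closed_set[OF K(1) this _ lim] show ?thesis
      by simp
  qed
  moreover have "H y \<bullet> d \<le> 0" if y: "y \<in> K" for y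
  proof -
    have "(\<lambda>n. s n *\<^sub>R y - s n *\<^sub>R X (Suc (r n))) \<longlonglongrightarrow> 0 *\<^sub>R y - d"
      by (intro tendsto_intros s0 sX)
    then have lim: "(\<lambda>n. H y \<bullet> (s n *\<^sub>R y - s n *\<^sub>R X (Suc (r n)))) \<longlonglongrightarrow> H y \<bullet> (0 *\<^sub>R y - d)"
      by (rule tendsto_inner[OF tendsto_const])
    have "filterlim (\<lambda>n. Suc (r n)) sequentially sequentially"
      using filterlim_compose[OF filterlim_Suc filterlim_subseq[OF r]] .
    then have "\<forall>\<^sub>F n in sequentially. H y \<bullet> (y - X (Suc (r n))) \<ge> 0"
      using minty[OF y] by (rule eventually_compose_filterlim[rotated])
    then have "\<forall>\<^sub>F n in sequentially. 0 \<le> H y \<bullet> (s n *\<^sub>R y - s n *\<^sub>R X (Suc (r n)))"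
    proof eventually_elim
      case (elim n)
      then show ?case
        using s_pos[of n] by (simp flip: scaleR_diff_right)
    qed
    from tendsto_lowerbound[OF lim this] show ?thesis
      by (simp add: inner_diff_right)
  qed
  ultimately have "d \<in> critical_directions K H"
    by (simp add: critical_directions_def)
  with d show ?thesis
    by (auto intro!: bexI[of _ d])
qed

text \<open>
  Solutions are exactly the fixed points of \<open>x \<mapsto> closest_point K (x - H x)\<close>, by the obtuse angle
  characterisation of the projection, so Brouwer's theorem provides one.
\<close>

lemma vi_solutions_compact_nonempty:
  fixes K :: "'v::euclidean_space set"
  assumes "compact K" "convex K" "K \<noteq> {}" and H: "continuous_on K H"
  shows "vi_solutions K H \<noteq> {}"
proof -
  have K: "closed K"
    using assms compact_imp_closed by blast
  have proj: "continuous_on UNIV (closest_point K)"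
    by (intro continuous_at_imp_continuous_on ballI continuous_at_closest_point assms K)
  have "continuous_on K (\<lambda>x. closest_point K (x - H x))"
    by (intro continuous_on_compose2[OF proj] continuous_intros H) auto
  moreover have "(\<lambda>x. closest_point K (x - H x)) \<in> K \<rightarrow> K"
    using closest_point_in_set[OF K assms(3)] by auto
  ultimately obtain x where x: "x \<in> K" "closest_point K (x - H x) = x"
    using brouwer[of K "\<lambda>x. closest_point K (x - H x)"] assms by blast
  have "H x \<bullet> (y - x) \<ge> 0" if "y \<in> K" for y
    using closest_point_dot[OF assms(2) K that, of "x - H x"] x by (simp add: inner_diff_left)
  with x show ?thesis
    by (auto simp: vi_solutions_def)
qed

text \<open>
  A small step from \<open>x\<close> towards any \<open>y \<in> K\<close> stays inside the ball, so the inequality against the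
  truncated set already contains the inequality against \<open>y\<close>.
\<close>

lemma vi_solution_interior_of_ball:
  fixes K :: "'v::euclidean_space set"
  assumes K: "convex K" and x: "x \<in> vi_solutions (K \<inter> cball 0 r) H" and less: "norm x < r"
  shows "x \<in> vi_solutions K H"
proof -
  have xK: "x \<in> K"
    using x by (simp add: vi_solutions_def)
  have "H x \<bullet> (y - x) \<ge> 0" if y: "y \<in> K" for y
  proof -
    define t where "t = min 1 ((r - norm x) / (norm (y - x) + 1))"
    have t: "0 < t" "t \<le> 1"
      using less by (auto simp: t_def add_nonneg_pos)
    have "t * norm (y - x) \<le> t * (norm (y - x) + 1)"
      using t by (intro mult_left_mono) auto
    also have "\<dots> \<le> (r - norm x) / (norm (y - x) + 1) * (norm (y - x) + 1)"
      by (intro mult_right_mono) (auto simp: t_def)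
    also have "\<dots> = r - norm x"
      using norm_ge_zero[of "y - x"] by (simp add: add_nonneg_eq_0_iff)
    finally have "norm (x + t *\<^sub>R (y - x)) \<le> r"
      using norm_triangle_ineq[of x "t *\<^sub>R (y - x)"] t by simp
    moreover have "x + t *\<^sub>R (y - x) \<in> K"
      using convexD[OF K xK y, of "1 - t" t] t by (simp add: algebra_simps)
    moreover have "\<forall>z \<in> K \<inter> cball 0 r. H x \<bullet> (z - x) \<ge> 0"
      using x by (simp add: vi_solutions_def)
    ultimately have "H x \<bullet> (x + t *\<^sub>R (y - x) - x) \<ge> 0"
      by (metis IntI mem_cball_0)
    with t show ?thesis
      by (simp add: zero_le_mult_iff)
  qed
  with xK show ?thesis
    by (simp add: vi_solutions_def)
qed

lemma vi_solutions_bounded: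
  fixes K :: "'v::euclidean_space set"
  assumes K: "closed K" "convex K" and H: "pseudomonotone K H"
    and triv: "critical_directions K H \<subseteq> {0}"
  shows "bounded (vi_solutions K H)"
proof (rule ccontr)
  assume "\<not> bounded (vi_solutions K H)"
  then have "\<exists>x \<in> vi_solutions K H. norm x \<ge> real n" for n
    unfolding bounded_iff by (meson linear)
  then obtain X where X: "\<And>n. X n \<in> vi_solutions K H" "\<And>n. norm (X n) \<ge> real n"
    by metis
  have "\<exists>d \<in> critical_directions K H. d \<noteq> 0"
  proof (rule unbounded_minty_sequence[OF K _ X(2)])
    show "X n \<in> K" for n
      using X(1)[of n] by (simp add: vi_solutions_def)
    show "\<forall>\<^sub>F n in sequentially. H y \<bullet> (y - X n) \<ge> 0" if "y \<in> K" for y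
      using vi_solution_minty[OF H X(1) that] by (simp add: always_eventually)
  qed
  with triv show False
    by blast
qed

lemma vi_solutions_nonempty:
  fixes K :: "'v::euclidean_space set"
  assumes K: "closed K" "convex K" "K \<noteq> {}"
    and H: "continuous_on K H" "pseudomonotone K H"
    and triv: "critical_directions K H \<subseteq> {0}"
  shows "vi_solutions K H \<noteq> {}"
proof
  assume none: "vi_solutions K H = {}"
  obtain x0 where x0: "x0 \<in> K"
    using K by blast
  \<comment> \<open>The radii are shifted by \<open>norm x0\<close> so that every truncated set is nonempty.\<close>
  define R where "R n = norm x0 + real n" for n
  have "\<exists>x. x \<in> vi_solutions (K \<inter> cball 0 (R n)) H" for n
  proof -
    have "x0 \<in> K \<inter> cball 0 (R n)"
      using x0 by (simp add: R_def)
    then have "vi_solutions (K \<inter> cball 0 (R n)) H \<noteq> {}"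
      using K by (intro vi_solutions_compact_nonempty closed_Int_compact convex_Int
          continuous_on_subset[OF H(1)]) auto
    then show ?thesis
      by blast
  qed
  then obtain X where X: "\<And>n. X n \<in> vi_solutions (K \<inter> cball 0 (R n)) H"
    by metis
  have "norm (X n) \<ge> R n" for n
    using vi_solution_interior_of_ball[OF K(2) X[of n]] none by force
  then have "norm (X n) \<ge> real n" for n
    using norm_ge_zero[of x0] by (smt (verit) R_def)
  moreover have XK: "X n \<in> K" for n
    using X[of n] by (simp add: vi_solutions_def)
  moreover have "\<forall>\<^sub>F n in sequentially. H y \<bullet> (y - X n) \<ge> 0" if y: "y \<in> K" for y
  proof -
    obtain m where m: "norm y \<le> real m"
      using real_arch_simple by blast
    have "H y \<bullet> (y - X n) \<ge> 0" if "n \<ge> m" for n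
    proof -
      have "norm y \<le> R n"
        using m that norm_ge_zero[of x0] of_nat_mono[OF that, where 'a = real] unfolding R_def by linarith
      then have "H (X n) \<bullet> (y - X n) \<ge> 0"
        using X[of n] y by (simp add: vi_solutions_def)
      with H(2) XK y show ?thesis
        by (auto simp: pseudomonotone_def)
    qed
    then show ?thesis
      by (auto simp: eventually_sequentially)
  qed
  ultimately have "\<exists>d \<in> critical_directions K H. d \<noteq> 0"
    by (intro unbounded_minty_sequence[OF K(1,2)])
  with triv show False
    by blast
qed

lemma zero_in_critical_directions: "0 \<in> critical_directions K H"
  by (simp add: critical_directions_def)

theorem vi_solutions_nonempty_bounded_iff:
  fixes K :: "'v::euclidean_space set"
  assumes K: "closed K" "convex K" "K \<noteq> {}"
    and H: "continuous_on K H" "pseudomonotone K H"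
  shows "vi_solutions K H \<noteq> {} \<and> bounded (vi_solutions K H) \<longleftrightarrow> critical_directions K H = {0}"
proof
  assume "critical_directions K H = {0}"
  then show "vi_solutions K H \<noteq> {} \<and> bounded (vi_solutions K H)"
    using vi_solutions_nonempty[OF assms] vi_solutions_bounded[OF K(1,2) H(2)] by simp
next
  assume sol: "vi_solutions K H \<noteq> {} \<and> bounded (vi_solutions K H)"
  then obtain x B where x: "x \<in> vi_solutions K H" and B: "\<And>z. z \<in> vi_solutions K H \<Longrightarrow> norm z \<le> B"
    unfolding bounded_iff by blast
  have "d = 0" if d: "d \<in> critical_directions K H" for d
  proof (rule ccontr)
    assume "d \<noteq> 0"
    \<comment> \<open>This step along \<open>d\<close> moves \<open>x\<close> to distance at least \<open>B + 1\<close> from the origin.\<close>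
    define \<tau> where "\<tau> = (norm x + \<bar>B\<bar> + 1) / norm d"
    have "\<tau> \<ge> 0"
      by (simp add: \<tau>_def)
    from B[OF vi_solution_plus_critical_direction[OF K(2) H x d this]]
    have "norm (x + \<tau> *\<^sub>R d) \<le> B" .
    moreover have "norm (\<tau> *\<^sub>R d) = norm x + \<bar>B\<bar> + 1"
      using \<open>d \<noteq> 0\<close> by (simp add: \<tau>_def)
    ultimately show False
      using norm_triangle_ineq4[of "x + \<tau> *\<^sub>R d" x] by simp
  qed
  then show "critical_directions K H = {0}"
    using zero_in_critical_directions by blast
qed

section \<open>The weighted inner product and its metric\<close>

definition weighted ::
  "('a::finite, 'k::finite) scenario set \<Rightarrow> (('a, 'k) scenario \<Rightarrow> real) \<Rightarrow>
    ('n::finite, 'a, 'k) policy \<Rightarrow> ('n, 'a, 'k) policy" where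
  "weighted \<Omega> p x = (\<chi> \<xi>. if \<xi> \<in> \<Omega> then p \<xi> *\<^sub>R x $ \<xi> else 0)"

lemma L_inner_eq_weighted: "L_inner st \<Omega> p x w = weighted \<Omega> p x \<bullet> w"
proof -
  have "weighted \<Omega> p x \<bullet> w = (\<Sum>\<xi>\<in>UNIV. if \<xi> \<in> \<Omega> then p \<xi> * (x $ \<xi> \<bullet> w $ \<xi>) else 0)"
    unfolding inner_vec_def[of "weighted \<Omega> p x"] by (rule sum.cong) (auto simp: weighted_def)
  then show ?thesis
    unfolding L_inner_def sum_block_inner by (simp add: sum.If_cases)
qed

lemma L_inner_commute: "L_inner st \<Omega> p x w = L_inner st \<Omega> p w x"
  by (simp add: L_inner_def inner_commute)

lemma continuous_on_weighted: "continuous_on S (weighted \<Omega> p)"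
proof -
  have "continuous_on S (\<lambda>x. if \<xi> \<in> \<Omega> then p \<xi> *\<^sub>R x $ \<xi> else 0)" for \<xi>
    by (cases "\<xi> \<in> \<Omega>") (auto intro!: continuous_intros)
  then show ?thesis
    unfolding weighted_def by (intro continuous_on_vec_lambda)
qed

lemma L_dist_le_dist:
  assumes pos: "\<forall>\<xi>\<in>\<Omega>. p \<xi> > 0" and sum: "(\<Sum>\<xi>\<in>\<Omega>. p \<xi>) = 1"
  shows "L_dist st \<Omega> p x y \<le> dist x y"
proof -
  have p1: "p \<xi> \<le> 1" if "\<xi> \<in> \<Omega>" for \<xi>
    using member_le_sum[OF that, of p] pos sum by (auto simp: less_imp_le)
  have "L_dist st \<Omega> p x y = norm (\<chi> \<xi>. if \<xi> \<in> \<Omega> then sqrt (p \<xi>) *\<^sub>R (x - y) $ \<xi> else 0)"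
    using pos by (intro L_dist_eq_norm) auto
  also have "\<dots> \<le> norm (x - y)"
    by (rule norm_le_componentwise_cart)
      (use p1 pos in \<open>auto intro!: mult_left_le_one_le simp: less_imp_le\<close>)
  finally show ?thesis
    by (simp add: dist_norm)
qed

text \<open>The smallest weight supplies the constant.\<close>

lemma dist_le_L_dist:
  fixes st :: "'n::finite \<Rightarrow> 'k::finite" and \<Omega> :: "('a::finite, 'k) scenario set"
  assumes pos: "\<forall>\<xi>\<in>\<Omega>. p \<xi> > 0" and "\<Omega> \<noteq> {}"
  obtains c where "c > 0"
    "\<And>x y. x \<in> L_space \<Omega> \<Longrightarrow> y \<in> L_space \<Omega> \<Longrightarrow> c * dist x y \<le> L_dist st \<Omega> p x y"
proof
  define c where "c = sqrt (Min (p ` \<Omega>))"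
  show "c > 0"
    using pos \<open>\<Omega> \<noteq> {}\<close> by (simp add: c_def)
  have c: "c \<le> sqrt (p \<xi>)" if "\<xi> \<in> \<Omega>" for \<xi>
    using that by (simp add: c_def)
  show "c * dist x y \<le> L_dist st \<Omega> p x y" if "x \<in> L_space \<Omega>" "y \<in> L_space \<Omega>" for x y
  proof -
    have "c * dist x y = norm (c *\<^sub>R (x - y))"
      using \<open>c > 0\<close> by (simp add: dist_norm)
    also have "\<dots> \<le> norm (\<chi> \<xi>. if \<xi> \<in> \<Omega> then sqrt (p \<xi>) *\<^sub>R (x - y) $ \<xi> else 0)"
    proof (rule norm_le_componentwise_cart)
      fix \<xi>
      show "norm ((c *\<^sub>R (x - y)) $ \<xi>)
          \<le> norm ((\<chi> \<xi>. if \<xi> \<in> \<Omega> then sqrt (p \<xi>) *\<^sub>R (x - y) $ \<xi> else 0) $ \<xi>)"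
        using that c[of \<xi>] \<open>c > 0\<close>
        by (cases "\<xi> \<in> \<Omega>") (auto simp: L_space_def intro!: mult_right_mono)
    qed
    also have "\<dots> = L_dist st \<Omega> p x y"
      using pos by (intro L_dist_eq_norm[symmetric]) auto
    finally show ?thesis .
  qed
qed

lemma L_topology_eq:
  fixes st :: "'n::finite \<Rightarrow> 'k::finite" and \<Omega> :: "('a::finite, 'k) scenario set"
  assumes pos: "\<forall>\<xi>\<in>\<Omega>. p \<xi> > 0" and sum: "(\<Sum>\<xi>\<in>\<Omega>. p \<xi>) = 1"
  shows "L_topology st \<Omega> p = top_of_set (L_space \<Omega>)"
proof -
  interpret Metric_space "L_space \<Omega> :: ('n, 'a, 'k) policy set" "L_dist st \<Omega> p"
    using pos by (intro Metric_space_L) auto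
  have "\<Omega> \<noteq> {}"
    using sum by auto
  from dist_le_L_dist[OF pos this, where st = st] obtain c where c: "c > 0"
    "\<And>x y. x \<in> L_space \<Omega> \<Longrightarrow> y \<in> L_space \<Omega> \<Longrightarrow> c * dist x y \<le> L_dist st \<Omega> p x y"
    by metis
  have le: "L_dist st \<Omega> p x y \<le> dist x y" for x y
    by (rule L_dist_le_dist[OF pos sum])
  have "(\<exists>r>0. mball x r \<subseteq> U) \<longleftrightarrow> (\<exists>e>0. ball x e \<inter> L_space \<Omega> \<subseteq> U)"
    if "U \<subseteq> L_space \<Omega>" "x \<in> U" for U x
  proof
    assume "\<exists>r>0. mball x r \<subseteq> U"
    then obtain r where "r > 0" "mball x r \<subseteq> U"
      by blast
    moreover have "ball x r \<inter> L_space \<Omega> \<subseteq> mball x r"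
      using le_less_trans[OF le] that by auto
    ultimately show "\<exists>e>0. ball x e \<inter> L_space \<Omega> \<subseteq> U"
      by blast
  next
    assume "\<exists>e>0. ball x e \<inter> L_space \<Omega> \<subseteq> U"
    then obtain e where e: "e > 0" "ball x e \<inter> L_space \<Omega> \<subseteq> U"
      by blast
    have "mball x (c * e) \<subseteq> ball x e \<inter> L_space \<Omega>"
    proof
      fix y assume y: "y \<in> mball x (c * e)"
      then have "c * dist x y < c * e"
        using c(2)[of x y] by auto
      with c(1) y show "y \<in> ball x e \<inter> L_space \<Omega>"
        by auto
    qed
    with e c(1) show "\<exists>r>0. mball x r \<subseteq> U"
      by (intro exI[of _ "c * e"]) auto
  qed
  then have "openin mtopology U \<longleftrightarrow> openin (top_of_set (L_space \<Omega>)) U" for U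
    unfolding openin_mtopology openin_contains_ball by auto
  then show ?thesis
    unfolding L_topology_def by (simp add: topology_eq)
qed

lemma L_space_subspace: "subspace (L_space \<Omega>)"
  by (auto simp: subspace_def L_space_def)

lemma L_bounded_iff:
  fixes st :: "'n::finite \<Rightarrow> 'k::finite" and \<Omega> :: "('a::finite, 'k) scenario set"
    and S :: "('n, 'a, 'k) policy set"
  assumes pos: "\<forall>\<xi>\<in>\<Omega>. p \<xi> > 0" and sum: "(\<Sum>\<xi>\<in>\<Omega>. p \<xi>) = 1"
    and S: "S \<subseteq> L_space \<Omega>"
  shows "L_bounded st \<Omega> p S \<longleftrightarrow> bounded S"
proof -
  interpret Metric_space "L_space \<Omega> :: ('n, 'a, 'k) policy set" "L_dist st \<Omega> p"
    using pos by (intro Metric_space_L) auto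
  have "\<Omega> \<noteq> {}"
    using sum by auto
  from dist_le_L_dist[OF pos this, where st = st] obtain c where c: "c > 0"
    "\<And>x y. x \<in> L_space \<Omega> \<Longrightarrow> y \<in> L_space \<Omega> \<Longrightarrow> c * dist x y \<le> L_dist st \<Omega> p x y"
    by metis
  show ?thesis
    unfolding L_bounded_def
  proof
    assume "mbounded S"
    then obtain a B where B: "S \<subseteq> mcball a B"
      by (auto simp: mbounded_def)
    have "dist a y \<le> B / c" if "y \<in> S" for y
    proof -
      have "y \<in> mcball a B"
        using B that by blast
      then have "c * dist a y \<le> B"
        using c(2)[of a y] by auto
      then show ?thesis
        using c(1) by (simp add: field_simps)
    qed
    then show "bounded S"
      unfolding bounded_def by blast
  next
    assume "bounded S"
    then obtain B where "\<And>y. y \<in> S \<Longrightarrow> dist 0 y \<le> B"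
      unfolding bounded_any_center[where a = 0] by blast
    then have "L_dist st \<Omega> p 0 y \<le> B" if "y \<in> S" for y
      using order_trans[OF L_dist_le_dist[OF pos sum]] that by blast
    then have "S \<subseteq> mcball 0 B"
      using S subspace_0[OF L_space_subspace] by (auto simp: subset_iff)
    then show "mbounded S"
      by (auto simp: mbounded_def)
  qed
qed

section \<open>The stochastic variational inequality\<close>

lemma block_add: "block st k (x + y) = block st k x + block st k y"
  by (simp add: block_def vec_eq_iff)

lemma block_scaleR: "block st k (c *\<^sub>R x) = c *\<^sub>R block st k x"
  by (simp add: block_def vec_eq_iff)

lemma nonanticipative_subspace: "subspace (nonanticipative st \<Omega>)"
  unfolding subspace_def
proof (intro conjI ballI allI)
  show "0 \<in> nonanticipative st \<Omega>"
    by (simp add: nonanticipative_def subspace_0[OF L_space_subspace])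
next
  fix x y assume xy: "x \<in> nonanticipative st \<Omega>" "y \<in> nonanticipative st \<Omega>"
  then have "x + y \<in> L_space \<Omega>"
    by (intro subspace_add L_space_subspace) (auto simp: nonanticipative_def)
  moreover have "block st k ((x + y) $ \<xi>) = block st k ((x + y) $ \<zeta>)"
    if "\<xi> \<in> \<Omega>" "\<zeta> \<in> \<Omega>" "\<forall>j<k. \<xi> $ j = \<zeta> $ j" for k \<xi> \<zeta>
  proof -
    have "block st k (x $ \<xi>) = block st k (x $ \<zeta>)" "block st k (y $ \<xi>) = block st k (y $ \<zeta>)"
      using xy that unfolding nonanticipative_def by blast+
    then show ?thesis
      by (simp add: block_add)
  qed
  ultimately show "x + y \<in> nonanticipative st \<Omega>"
    unfolding nonanticipative_def by blast
next
  fix c x assume x: "x \<in> nonanticipative st \<Omega>"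
  then have "c *\<^sub>R x \<in> L_space \<Omega>"
    by (intro subspace_scale L_space_subspace) (auto simp: nonanticipative_def)
  moreover have "block st k ((c *\<^sub>R x) $ \<xi>) = block st k ((c *\<^sub>R x) $ \<zeta>)"
    if "\<xi> \<in> \<Omega>" "\<zeta> \<in> \<Omega>" "\<forall>j<k. \<xi> $ j = \<zeta> $ j" for k \<xi> \<zeta>
  proof -
    have "block st k (x $ \<xi>) = block st k (x $ \<zeta>)"
      using x that unfolding nonanticipative_def by blast
    then show ?thesis
      by (simp add: block_scaleR)
  qed
  ultimately show "c *\<^sub>R x \<in> nonanticipative st \<Omega>"
    unfolding nonanticipative_def by blast
qed

lemma constraint_set_convex:
  assumes "\<And>\<xi>. \<xi> \<in> \<Omega> \<Longrightarrow> convex (C \<xi>)"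
  shows "convex (constraint_set \<Omega> C)"
  unfolding convex_def constraint_set_def
proof (intro ballI allI impI CollectI conjI)
  fix x y and u v :: real
  assume *: "x \<in> {x \<in> L_space \<Omega>. \<forall>\<xi>\<in>\<Omega>. x $ \<xi> \<in> C \<xi>}"
    "y \<in> {x \<in> L_space \<Omega>. \<forall>\<xi>\<in>\<Omega>. x $ \<xi> \<in> C \<xi>}" "0 \<le> u" "0 \<le> v" "u + v = 1"
  then show "u *\<^sub>R x + v *\<^sub>R y \<in> L_space \<Omega>"
    by (simp add: L_space_def)
  show "(u *\<^sub>R x + v *\<^sub>R y) $ \<xi> \<in> C \<xi>" if "\<xi> \<in> \<Omega>" for \<xi>
    using * convexD[OF assms[OF that], of "x $ \<xi>" "y $ \<xi>" u v] that by simp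
qed

lemma constraint_set_closed:
  assumes "\<And>\<xi>. \<xi> \<in> \<Omega> \<Longrightarrow> closed (C \<xi>)"
  shows "closed (constraint_set \<Omega> C)"
proof -
  have "constraint_set \<Omega> C = L_space \<Omega> \<inter> (\<Inter>\<xi>\<in>\<Omega>. (\<lambda>x. x $ \<xi>) -` C \<xi>)"
    by (auto simp: constraint_set_def)
  then show ?thesis
    using assms
    by (auto intro!: closed_Int closed_INT closed_subspace[OF L_space_subspace] closed_vimage
        continuous_intros)
qed

lemma SOL_eq_vi_solutions:
  "SOL st \<Omega> p K G = vi_solutions K (\<lambda>x. weighted \<Omega> p (G x))"
  by (simp add: SOL_def vi_solutions_def L_inner_eq_weighted)

lemma pseudomonotone_on_iff:
  "pseudomonotone_on st \<Omega> p K G \<longleftrightarrow> pseudomonotone K (\<lambda>x. weighted \<Omega> p (G x))"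
  unfolding pseudomonotone_on_def pseudomonotone_def L_inner_commute[of st \<Omega> p _ "G _"]
  unfolding L_inner_eq_weighted ..

text \<open>
  A direction of recession of a nonempty subset of the policy space is a difference of two of its
  points; hence it vanishes outside \<open>\<Omega>\<close>.
\<close>

lemma recession_dual_eq_critical_directions:
  assumes K: "K \<subseteq> L_space \<Omega>" "K \<noteq> {}"
  shows "recession_cone \<Omega> K \<inter> uminus ` dual_cone st \<Omega> p (G ` K)
    = critical_directions K (\<lambda>x. weighted \<Omega> p (G x))" (is "?L = ?R")
proof
  show "?L \<subseteq> ?R"
    by (auto simp: recession_cone_def dual_cone_def critical_directions_def L_inner_eq_weighted)
  show "?R \<subseteq> ?L"
  proof
    fix d assume d: "d \<in> ?R"
    obtain x where x: "x \<in> K"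
      using K by blast
    have "x + 1 *\<^sub>R d \<in> K"
      using d x unfolding critical_directions_def by (auto simp del: scaleR_one)
    with x K have "(x + 1 *\<^sub>R d) - x \<in> L_space \<Omega>"
      by (intro subspace_diff L_space_subspace) auto
    then have "d \<in> L_space \<Omega>"
      by simp
    moreover from this have "- d \<in> L_space \<Omega>"
      by (simp add: L_space_def)
    ultimately have "d \<in> recession_cone \<Omega> K" "- d \<in> dual_cone st \<Omega> p (G ` K)"
      using d by (auto simp: recession_cone_def dual_cone_def critical_directions_def
          L_inner_eq_weighted)
    then show "d \<in> ?L"
      by (metis IntI image_eqI minus_minus)
  qed
qed

text \<open>
  Over the empty set both cones are the whole policy space, so the cone condition fails, just as
  solvability does.
\<close>

lemma recession_dual_empty:
  fixes st :: "'n::finite \<Rightarrow> 'k::finite" and \<Omega> :: "('a::finite, 'k) scenario set"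
  assumes "\<Omega> \<noteq> {}"
  shows "recession_cone \<Omega> {} \<inter> uminus ` dual_cone st \<Omega> p (G ` {}) \<noteq> {0}"
proof -
  obtain \<xi> where \<xi>: "\<xi> \<in> \<Omega>"
    using assms by blast
  define d :: "('n, 'a, 'k) policy" where "d = axis \<xi> 1"
  have "d \<noteq> 0" "d \<in> L_space \<Omega>" "- d \<in> L_space \<Omega>"
    using \<xi> by (auto simp: d_def axis_eq_0_iff L_space_def) (auto simp: axis_def)
  then have "d \<in> recession_cone \<Omega> {} \<inter> uminus ` dual_cone st \<Omega> p (G ` {})"
    by (auto simp: recession_cone_def dual_cone_def intro!: image_eqI[of d uminus "- d"])
  with \<open>d \<noteq> 0\<close> show ?thesis
    by blast
qed

theorem theorem7:
  fixes \<Xi> :: "'k::{finite,linorder} \<Rightarrow> 'a::finite set"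
    and \<Omega> :: "('a, 'k) scenario set"
    and p :: "('a, 'k) scenario \<Rightarrow> real"
    and st :: "'n::finite \<Rightarrow> 'k"
    and C :: "('a, 'k) scenario \<Rightarrow> (real ^ 'n) set"
    and F :: "real ^ 'n \<Rightarrow> ('a, 'k) scenario \<Rightarrow> real ^ 'n"
    and K :: "('n, 'a, 'k) policy set"
  assumes "surj st"
    and "\<Omega> = {\<xi>. \<forall>k. \<xi> $ k \<in> \<Xi> k}"
    and "\<And>\<xi>. \<xi> \<in> \<Omega> \<Longrightarrow> p \<xi> > 0"
    and "(\<Sum>\<xi>\<in>\<Omega>. p \<xi>) = 1"
    and "\<And>\<xi>. \<xi> \<in> \<Omega> \<Longrightarrow> C \<xi> \<noteq> {} \<and> closed (C \<xi>) \<and> convex (C \<xi>)"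
    and "K = constraint_set \<Omega> C \<inter> nonanticipative st \<Omega>"
    and "continuous_map (L_topology st \<Omega> p) (L_topology st \<Omega> p) (scenario_map \<Omega> F)"
    and "pseudomonotone_on st \<Omega> p K (scenario_map \<Omega> F)"
  shows "SOL st \<Omega> p K (scenario_map \<Omega> F) \<noteq> {} \<and>
    L_bounded st \<Omega> p (SOL st \<Omega> p K (scenario_map \<Omega> F))
    \<longleftrightarrow> recession_cone \<Omega> K \<inter> uminus ` dual_cone st \<Omega> p (scenario_map \<Omega> F ` K) = {0}"
proof -
  let ?G = "scenario_map \<Omega> F"
  let ?H = "\<lambda>x. weighted \<Omega> p (?G x)"
  note sum = assms(4)
  have pos: "\<forall>\<xi>\<in>\<Omega>. p \<xi> > 0"
    using assms(3) by blast
  have \<Omega>: "\<Omega> \<noteq> {}"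
    using sum by auto
  have KL: "K \<subseteq> L_space \<Omega>"
    using assms(6) by (auto simp: constraint_set_def)
  have "closed K" "convex K"
    using assms(5) unfolding assms(6)
    by (auto intro!: closed_Int convex_Int constraint_set_closed constraint_set_convex
        closed_subspace[OF nonanticipative_subspace] subspace_imp_convex[OF nonanticipative_subspace])
  moreover have "continuous_on (L_space \<Omega>) ?G"
    using assms(7) unfolding L_topology_eq[OF pos sum] continuous_map_in_subtopology by simp
  then have "continuous_on K ?H"
    using continuous_on_compose2[OF continuous_on_weighted[of UNIV]] continuous_on_subset[OF _ KL]
    by blast
  moreover have "pseudomonotone K ?H"
    using assms(8) by (simp add: pseudomonotone_on_iff)
  ultimately have main: "vi_solutions K ?H \<noteq> {} \<and> bounded (vi_solutions K ?H)
      \<longleftrightarrow> critical_directions K ?H = {0}" if "K \<noteq> {}"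
    using that by (intro vi_solutions_nonempty_bounded_iff)
  have SOL: "SOL st \<Omega> p K ?G = vi_solutions K ?H"
    by (rule SOL_eq_vi_solutions)
  have bounded: "L_bounded st \<Omega> p (SOL st \<Omega> p K ?G) \<longleftrightarrow> bounded (SOL st \<Omega> p K ?G)"
    using KL by (intro L_bounded_iff pos sum) (auto simp: SOL_def)
  show ?thesis
  proof (cases "K = {}")
    case True
    then show ?thesis
      using recession_dual_empty[OF \<Omega>] by (simp add: SOL_def)
  next
    case False
    show ?thesis
      unfolding bounded unfolding SOL recession_dual_eq_critical_directions[OF KL False]
      by (rule main[OF False])
  qed
qed

end
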